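(* For any $s$ satisfying $\log_5 3<s<1$, there exists a compact set $F\subseteq\mathbb{R}^2$ with Hausdorff and Assouad dimension both equal to $s$ for which there are two disjoint intervals $I,J\subseteq[0,\pi)$, each of positive length, such that $$\dim_{\mathrm{A}}\pi_\theta F=s\quad\text{for all }\theta\in I,\qquad \dim_{\mathrm{A}}\pi_\theta F=1\quad\text{for Lebesgue almost all }\theta\in J.$$ In particular, $\theta\mapsto\dim_{\mathrm{A}}\pi_\theta F$ is not an almost surely constant function on $[0,\pi)$ (that is, it is not equal to a single constant for Lebesgue almost every $\theta$).
   Context: For $\theta\in[0,\pi)$, $\pi_\theta$ denotes orthogonal projection of $\mathbb{R}^2$ onto the line through the origin forming angle $\theta$ with the positive $x$-axis. For a non-empty set $E$ and $r>0$, $N_r(E)$ is the smallest number of open sets of diameter at most $r$ needed to cover $E$. The Assouad dimension of a non-empty set $F\subseteq\mathbb{R}^d$ is $$\dim_{\mathrm{A}}F=\inf\Big\{s\ge 0:\ (\exists C>0)(\forall R>0)(\forall r\in(0,R))(\forall x\in F)\ N_r(B(x,R)\cap F)\le C\Big(\frac{R}{r}\Big)^s\Big\},$$ where $B(x,R)$ is the open Euclidean ball. *)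

theory Defs
  imports "HOL-Analysis.Analysis"
begin

(* The library's diameter is a real number, unspecified for unbounded sets; covering sets are
   therefore always required to be bounded. *)

(* Infinity if E has no finite cover by open sets of diameter at most r. *)
definition covering_number :: "real \<Rightarrow> 'a::metric_space set \<Rightarrow> enat" where
  "covering_number r E =
     Inf {enat (card \<U>) | \<U>. finite \<U> \<and> E \<subseteq> \<Union>\<U> \<and>
            (\<forall>U\<in>\<U>. open U \<and> bounded U \<and> diameter U \<le> r)}"

(* Extended-real-valued, so that the infimum over an empty set of exponents is infinity. *)
definition assouad_dim :: "'a::metric_space set \<Rightarrow> ereal" where
  "assouad_dim F =
     Inf {ereal s | s. 0 \<le> s \<and>
            (\<exists>C>0. \<forall>R>0. \<forall>r\<in>{0<..<R}. \<forall>x\<in>F.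
               ereal_of_enat (covering_number r (ball x R \<inter> F)) \<le> ereal (C * (R / r) powr s))}"

(* diam(U)^s with the usual conventions: the empty set contributes 0, and 0^0 = 1 for
   non-empty U (in the library, 0 powr 0 = 0). *)
definition diam_pow :: "real \<Rightarrow> 'a::metric_space set \<Rightarrow> ennreal" where
  "diam_pow s U = (if U = {} then 0 else if s = 0 then 1 else ennreal (diameter U powr s))"

definition hausdorff_premeasure :: "real \<Rightarrow> real \<Rightarrow> 'a::metric_space set \<Rightarrow> ennreal" where
  "hausdorff_premeasure s \<delta> F =
     Inf {(\<Sum>i. diam_pow s (U i)) | U :: nat \<Rightarrow> 'a set.
            F \<subseteq> (\<Union>i. U i) \<and> (\<forall>i. bounded (U i) \<and> diameter (U i) \<le> \<delta>)}"

definition hausdorff_measure :: "real \<Rightarrow> 'a::metric_space set \<Rightarrow> ennreal" where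
  "hausdorff_measure s F = (SUP \<delta>\<in>{0<..}. hausdorff_premeasure s \<delta> F)"

definition hausdorff_dim :: "'a::metric_space set \<Rightarrow> ereal" where
  "hausdorff_dim F = Inf {ereal s | s. 0 \<le> s \<and> hausdorff_measure s F = 0}"

definition direction :: "real \<Rightarrow> real^2" where
  "direction \<theta> = vector [cos \<theta>, sin \<theta>]"

definition line_proj :: "real \<Rightarrow> real^2 \<Rightarrow> real^2" where
  "line_proj \<theta> x = (x \<bullet> direction \<theta>) *\<^sub>R direction \<theta>"

lemma norm_direction: "norm (direction \<theta>) = 1"
  by (simp add: direction_def norm_eq_sqrt_inner inner_vec_def sum_2 flip: power2_eq_square)

lemma line_proj_in_line: "line_proj \<theta> x \<in> span {direction \<theta>}"
  by (simp add: line_proj_def span_base span_scale)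

lemma line_proj_orthogonal:
  assumes "y \<in> span {direction \<theta>}"
  shows "orthogonal (x - line_proj \<theta> x) y"
  using assms norm_direction[of \<theta>]
  by (auto simp: span_singleton orthogonal_def line_proj_def inner_diff_left norm_eq_1)

end

theory Submission
  imports Defs
begin

text \<open>
  Put \<open>lam = (1/2) powr (1/s)\<close>, which is less than \<open>1/2\<close>, and send a binary sequence \<open>a\<close> to the
  point of height \<open>y(a) = (\<Sum>j. a j * lam^j)\<close> and abscissa \<open>x(a) = (\<Sum>j. a j * lam^j * w_j(a))\<close>, where
  the weight \<open>w_j(a)\<close> is bounded by 2 and depends only on \<open>a 0, ..., a (j - 1)\<close>. The heights form a
  self-similar Cantor set of dimension \<open>s\<close>. If \<open>a\<close> and \<open>b\<close> first differ at index \<open>n\<close>, then their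
  heights differ by an amount comparable to \<open>lam^n\<close>, and since the weights are predictable their
  abscissas differ by at most a constant times \<open>lam^n\<close>. So the set \<open>F\<close> of all these points is the
  graph of a Lipschitz function over the Cantor set, and it, like its projections to nearly vertical
  lines, is a bi-Lipschitz copy of the space of binary sequences with the metric \<open>lam^n\<close>. All such
  copies are compact with Hausdorff and Assouad dimension \<open>s\<close> (locale \<open>cantor_coding\<close>). Only the
  predictability and the bound of the weights enter here, and this leaves a lot of freedom.

  The freedom is used to make the projections to nearly horizontal lines contain long arithmetic
  progressions up to small relative errors, which forces Assouad dimension 1. The
  projection in direction \<open>\<theta>\<close> is, up to the factor \<open>cos \<theta>\<close>, the function \<open>x + t * y\<close> with
  \<open>t = tan \<theta>\<close>. The sequences whose first zero is at index \<open>m\<close> form a cylinder, and different \<open>m\<close> give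
  disjoint cylinders, so a different pattern can be written in each. Every \<open>m\<close> is the number
  of a pair \<open>(n, q)\<close> of a length and a rational slope. In its cylinder, the digit \<open>u i\<close>, \<open>i < n\<close>,
  following the first zero gets the weight \<open>(2 * lam)^(n - i) - q\<close>. In \<open>x + t * y\<close> it then
  contributes \<open>u i * lam^(m + 1 + i) * ((2 * lam)^(n - i) + t - q)\<close>. The powers of \<open>lam\<close>
  multiply out to \<open>lam^(m + 1 + n) * 2^(n - i)\<close>, so as \<open>u\<close> runs through all binary words of length \<open>n\<close>,
  the \<open>2^n\<close> values are those of a progression with gap \<open>2 * lam^(m + 1 + n)\<close>, with an error that is
  small against the gap once \<open>\<bar>t - q\<bar> \<le> lam^n / 4\<close> (\<open>block_code_near_progression\<close>). Since the rationals are dense,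
  every \<open>t\<close> in \<open>[0, 1]\<close> has such a \<open>q\<close> for every \<open>n\<close>, so dimension 1 occurs for every \<open>\<theta>\<close> in
  \<open>[0, pi/4]\<close>.
\<close>

section \<open>Covering numbers\<close>

lemma diameter_le_dist:
  fixes S :: "'a::metric_space set"
  assumes "0 \<le> \<delta>" "\<And>x y. x \<in> S \<Longrightarrow> y \<in> S \<Longrightarrow> dist x y \<le> \<delta>"
  shows "diameter S \<le> \<delta>"
  using assms by (auto simp: diameter_def intro!: cSUP_least)

lemma diameter_ball_le:
  fixes x :: "'a::metric_space"
  assumes "0 \<le> \<rho>"
  shows "diameter (ball x \<rho>) \<le> 2 * \<rho>"
proof (rule diameter_le_dist)
  fix y z assume "y \<in> ball x \<rho>" "z \<in> ball x \<rho>"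
  then show "dist y z \<le> 2 * \<rho>"
    using dist_triangle2[of y z x] by (simp add: dist_commute)
qed (use assms in simp)

lemma covering_number_le_balls:
  assumes "finite P" "0 < r" "E \<subseteq> (\<Union>x\<in>P. ball x (r / 2))"
  shows "covering_number r E \<le> enat (card P)"
proof -
  let ?U = "(\<lambda>x. ball x (r / 2)) ` P"
  have "covering_number r E \<le> enat (card ?U)"
    unfolding covering_number_def
  proof (rule Inf_lower, safe intro!: exI[of _ ?U])
    fix x assume "x \<in> P"
    show "diameter (ball x (r / 2)) \<le> r"
      using diameter_ball_le[of "r / 2" x] \<open>0 < r\<close> by simp
  qed (use assms in \<open>auto simp: subset_iff\<close>)
  also have "\<dots> \<le> enat (card P)"
    using card_image_le[OF assms(1)] by simp
  finally show ?thesis .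
qed

text \<open>A set of diameter at most \<open>r\<close> cannot contain two points of an \<open>r\<close>-separated set, so choosing a
  covering set around each of its points is injective.\<close>

lemma card_separated_le_covering_number:
  assumes "P \<subseteq> E" "\<And>x y. x \<in> P \<Longrightarrow> y \<in> P \<Longrightarrow> x \<noteq> y \<Longrightarrow> r < dist x y"
  shows "enat (card P) \<le> covering_number r E"
  unfolding covering_number_def
proof (rule Inf_greatest, safe)
  fix \<U> assume \<U>: "finite \<U>" "E \<subseteq> \<Union>\<U>" "\<forall>U\<in>\<U>. open U \<and> bounded U \<and> diameter U \<le> r"
  define U where "U x = (SOME V. V \<in> \<U> \<and> x \<in> V)" for x
  have U: "U x \<in> \<U>" "x \<in> U x" if "x \<in> P" for x
    using someI_ex[of "\<lambda>V. V \<in> \<U> \<and> x \<in> V"] that assms(1) \<U>(2) unfolding U_def by blast+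
  have "inj_on U P"
  proof (rule inj_onI, rule ccontr)
    fix x y assume xy: "x \<in> P" "y \<in> P" "U x = U y" "x \<noteq> y"
    have "dist x y \<le> diameter (U x)"
      using U xy \<U>(3) by (intro diameter_bounded_bound) auto
    with assms(2)[of x y] xy U[of x] \<U>(3) show False by fastforce
  qed
  then have "card P \<le> card \<U>"
    using U \<U>(1) by (intro card_inj_on_le[of U]) auto
  then show "enat (card P) \<le> enat (card \<U>)" by simp
qed

lemma covering_number_attained:
  assumes "covering_number r E \<noteq> \<infinity>"
  obtains \<U> where "finite \<U>" "E \<subseteq> \<Union>\<U>" "\<And>U. U \<in> \<U> \<Longrightarrow> open U \<and> bounded U \<and> diameter U \<le> r"
    "covering_number r E = enat (card \<U>)"
proof -
  let ?S = "{enat (card \<U>) | \<U>. finite \<U> \<and> E \<subseteq> \<Union>\<U> \<and>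
            (\<forall>U\<in>\<U>. open U \<and> bounded U \<and> diameter U \<le> r)}"
  have "?S \<noteq> {}"
    using assms unfolding covering_number_def by (metis Inf_empty top_enat_def)
  then have "Inf ?S \<in> ?S"
    by (metis (no_types, lifting) LeastI equals0I Inf_enat_def)
  then show thesis
    using that unfolding covering_number_def by blast
qed

section \<open>Assouad dimension\<close>

text \<open>Balls with arbitrary centres may serve as covers, so exhibiting finite sets of centres suffices.\<close>

lemma assouad_dim_le:
  fixes F :: "'a::metric_space set"
  assumes "0 \<le> s" "0 < C"
    and "\<And>R r x. 0 < r \<Longrightarrow> r < R \<Longrightarrow> x \<in> F \<Longrightarrow>
           \<exists>P. finite P \<and> ball x R \<inter> F \<subseteq> (\<Union>y\<in>P. ball y (r / 2)) \<and> real (card P) \<le> C * (R / r) powr s"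
  shows "assouad_dim F \<le> ereal s"
  unfolding assouad_dim_def
proof (rule Inf_lower, simp, intro conjI exI[of _ C] allI impI ballI assms(1,2))
  fix R r :: real and x assume "0 < R" and r: "r \<in> {0<..<R}" and x: "x \<in> F"
  obtain P where P: "finite P" "ball x R \<inter> F \<subseteq> (\<Union>y\<in>P. ball y (r / 2))"
    "real (card P) \<le> C * (R / r) powr s"
    using assms(3) r x by force
  have "ereal_of_enat (covering_number r (ball x R \<inter> F)) \<le> ereal_of_enat (enat (card P))"
    using covering_number_le_balls[OF P(1) _ P(2)] r by (subst ereal_of_enat_le_iff) simp
  also have "\<dots> \<le> ereal (C * (R / r) powr s)"
    using P(3) by simp
  finally show "ereal_of_enat (covering_number r (ball x R \<inter> F)) \<le> ereal (C * (R / r) powr s)" .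
qed

text \<open>The criterion for full dimension: at unboundedly many relative scales \<open>R / r\<close>, up to the
  constant \<open>M\<close>, there are as many \<open>r\<close>-separated points in an \<open>R\<close>-ball as in an interval. Along
  \<open>R / r = M * 2^n\<close> an exponent \<open>s < 1\<close> would give \<open>2^n \<le> C * (M * 2^n) powr s\<close> for all \<open>n\<close>.\<close>

lemma one_le_assouad_dim_if_separated:
  fixes F :: "'a::metric_space set"
  assumes "0 < M"
    and "\<And>n. \<exists>P x (R::real) r. x \<in> F \<and> 0 < r \<and> r < R \<and> R \<le> M * 2 ^ n * r \<and> P \<subseteq> ball x R \<inter> F \<and>
            card P = 2 ^ n \<and> (\<forall>x\<in>P. \<forall>y\<in>P. x \<noteq> y \<longrightarrow> r < dist x y)"
  shows "1 \<le> assouad_dim F"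
  unfolding assouad_dim_def
proof (rule Inf_greatest, clarsimp)
  fix s C :: real
  assume "0 \<le> s" "0 < C" and C: "\<forall>R>0. \<forall>r\<in>{0<..<R}. \<forall>x\<in>F.
    ereal_of_enat (covering_number r (ball x R \<inter> F)) \<le> ereal (C * (R / r) powr s)"
  have bd: "(2::real) ^ n \<le> C * (M * 2 ^ n) powr s" for n
  proof -
    obtain P x and R r :: real where P: "x \<in> F" "0 < r" "r < R" "R \<le> M * 2 ^ n * r" "P \<subseteq> ball x R \<inter> F"
        "card P = 2 ^ n" "\<forall>x\<in>P. \<forall>y\<in>P. x \<noteq> y \<longrightarrow> r < dist x y"
      using assms(2)[of n] by blast
    have "enat (card P) \<le> covering_number r (ball x R \<inter> F)"
      using P by (intro card_separated_le_covering_number) auto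
    then have "ereal_of_enat (enat (card P)) \<le> ereal_of_enat (covering_number r (ball x R \<inter> F))"
      by (subst ereal_of_enat_le_iff)
    also have "\<dots> \<le> ereal (C * (R / r) powr s)"
      using C P by auto
    finally have "2 ^ n \<le> C * (R / r) powr s" using P(6) by simp
    also have "\<dots> \<le> C * (M * 2 ^ n) powr s"
      using P \<open>0 < C\<close> \<open>0 \<le> s\<close>
      by (intro mult_left_mono powr_mono2) (auto simp: divide_simps)
    finally show ?thesis .
  qed
  show "1 \<le> s"
  proof (rule ccontr)
    assume "\<not> 1 \<le> s"
    define q where "q = 2 powr (1 - s)"
    have "1 < q" unfolding q_def using \<open>\<not> 1 \<le> s\<close> by simp
    then obtain n where n: "C * M powr s < q ^ n"
      using real_arch_pow by blast
    have "q ^ n * (2 ^ n) powr s = 2 ^ n"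
      unfolding q_def by (simp add: powr_realpow[symmetric] powr_powr powr_add[symmetric] algebra_simps)
    also have "\<dots> \<le> C * M powr s * (2 ^ n) powr s"
      using bd[of n] \<open>0 < M\<close> by (simp add: powr_mult)
    finally have "q ^ n \<le> C * M powr s"
      by (metis mult_le_cancel_right_pos powr_gt_zero power_not_zero zero_neq_numeral)
    with n show False by simp
  qed
qed

lemma assouad_dim_line_subset_le:
  fixes d :: "'a::real_normed_vector"
  assumes d: "norm d = 1" and F: "F \<subseteq> range (\<lambda>t. t *\<^sub>R d)"
  shows "assouad_dim F \<le> 1"
proof -
  have "assouad_dim F \<le> ereal 1"
  proof (rule assouad_dim_le[where C = 6])
    fix R r :: real and x assume r: "0 < r" "r < R" and "x \<in> F"
    then obtain a where a: "x = a *\<^sub>R d" using F by auto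
    \<comment> \<open>Centres at spacing \<open>r / 2\<close> from \<open>x\<close>: rounding down then costs strictly less than \<open>r / 2\<close>.\<close>
    define N where "N = {\<lfloor>-(2 * R / r)\<rfloor>..\<lfloor>2 * R / r\<rfloor>}"
    define c where "c i = (a + of_int i * (r / 2)) *\<^sub>R d" for i :: int
    have dst: "dist (u *\<^sub>R d) (v *\<^sub>R d) = \<bar>u - v\<bar>" for u v
      by (simp add: dist_norm d flip: scaleR_left_diff_distrib)
    have "ball x R \<inter> F \<subseteq> (\<Union>y\<in>c ` N. ball y (r / 2))"
    proof
      fix y assume y: "y \<in> ball x R \<inter> F"
      then obtain b where b: "y = b *\<^sub>R d" using F by auto
      have "\<bar>b - a\<bar> < R" using y dst[of a b] by (auto simp: a b)
      define i where "i = \<lfloor>(b - a) / (r / 2)\<rfloor>"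
      have "-(2 * R / r) \<le> (b - a) / (r / 2)" "(b - a) / (r / 2) \<le> 2 * R / r"
        using \<open>\<bar>b - a\<bar> < R\<close> r by (simp_all add: divide_simps)
      then have "i \<in> N" unfolding N_def i_def by (auto intro: floor_mono)
      have "of_int i \<le> (b - a) / (r / 2)" "(b - a) / (r / 2) < of_int i + 1"
        unfolding i_def by linarith+
      then have "of_int i * (r / 2) \<le> b - a" "b - a < of_int i * (r / 2) + r / 2"
        using r by (simp_all add: field_simps)
      then have "\<bar>a + of_int i * (r / 2) - b\<bar> < r / 2" by linarith
      then have "dist (c i) y < r / 2" by (simp only: c_def b dst)
      with \<open>i \<in> N\<close> show "y \<in> (\<Union>y\<in>c ` N. ball y (r / 2))" by auto
    qed
    moreover have "real (card (c ` N)) \<le> 6 * (R / r) powr 1"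
    proof -
      have "card (c ` N) \<le> card N" by (rule card_image_le) (simp add: N_def)
      then have "real (card (c ` N)) \<le> real (nat (\<lfloor>2 * R / r\<rfloor> + 1 - \<lfloor>-(2 * R / r)\<rfloor>))"
        by (simp add: N_def)
      also have "\<dots> \<le> 4 * (R / r) + 2"
      proof -
        have "0 \<le> 2 * R / r" using r by simp
        then show ?thesis by (auto; linarith)
      qed
      also have "\<dots> \<le> 6 * (R / r)" using r by (simp add: field_simps)
      finally show ?thesis using r by simp
    qed
    ultimately show "\<exists>P. finite P \<and> ball x R \<inter> F \<subseteq> (\<Union>y\<in>P. ball y (r / 2)) \<and>
        real (card P) \<le> 6 * (R / r) powr 1"
      by (intro exI[of _ "c ` N"]) (auto simp: N_def)
  qed simp_all
  then show ?thesis by (simp add: one_ereal_def)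
qed

section \<open>Hausdorff dimension\<close>

text \<open>A finite cover becomes a countable one by padding with empty sets, which have \<open>diam_pow\<close> equal
  to 0 for every exponent.\<close>

lemma hausdorff_premeasure_le_finite_cover:
  assumes "finite \<U>" "E \<subseteq> \<Union>\<U>" "\<And>U. U \<in> \<U> \<Longrightarrow> bounded U \<and> diameter U \<le> \<delta>" "0 \<le> \<delta>"
  shows "hausdorff_premeasure t \<delta> E \<le> (\<Sum>U\<in>\<U>. diam_pow t U)"
proof -
  obtain h where h: "bij_betw h {..<card \<U>} \<U>"
    using ex_bij_betw_nat_finite[OF assms(1)] by (auto simp: atLeast0LessThan)
  define V where "V i = (if i < card \<U> then h i else {})" for i
  have V_in: "h i \<in> \<U>" if "i < card \<U>" for i
    using h that by (auto simp: bij_betw_def)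
  have "hausdorff_premeasure t \<delta> E \<le> (\<Sum>i. diam_pow t (V i))"
    unfolding hausdorff_premeasure_def
  proof (rule Inf_lower, safe intro!: exI[of _ V])
    fix x assume "x \<in> E"
    then obtain U where "U \<in> \<U>" "x \<in> U" using assms(2) by auto
    then obtain i where "i < card \<U>" "h i = U" using h by (metis bij_betw_iff_bijections lessThan_iff)
    then show "x \<in> (\<Union>i. V i)" using \<open>x \<in> U\<close> by (auto simp: V_def intro!: exI[of _ i])
  qed (use assms V_in in \<open>auto simp: V_def\<close>)
  also have "\<dots> = (\<Sum>i<card \<U>. diam_pow t (V i))"
    by (rule suminf_finite) (auto simp: V_def diam_pow_def)
  also have "\<dots> = (\<Sum>U\<in>\<U>. diam_pow t U)"
    using sum.reindex_bij_betw[OF h, of "diam_pow t"] by (simp add: V_def)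
  finally show ?thesis .
qed

text \<open>If \<open>s\<close> is an exponent for the Assouad dimension and \<open>R\<close> is larger than the set, then covers at
  scale \<open>r\<close> need at most a constant times \<open>r powr (- s)\<close> sets. For \<open>t > s\<close> their total \<open>t\<close>-dimensional
  size is at most a constant times \<open>r powr (t - s)\<close>, which tends to 0.\<close>

lemma hausdorff_dim_le_assouad_dim:
  fixes E :: "'a::metric_space set"
  assumes "bounded E" "E \<noteq> {}"
  shows "hausdorff_dim E \<le> assouad_dim E"
  unfolding assouad_dim_def
proof (rule Inf_greatest, clarsimp)
  fix s C :: real
  assume "0 \<le> s" "0 < C" and C: "\<forall>R>0. \<forall>r\<in>{0<..<R}. \<forall>x\<in>E.
    ereal_of_enat (covering_number r (ball x R \<inter> E)) \<le> ereal (C * (R / r) powr s)"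
  obtain x where x: "x \<in> E" using assms by auto
  obtain R0 where R0: "E \<subseteq> ball x R0"
    using assms(1) bounded_subset_ballD by blast
  define R where "R = max 1 R0"
  have R: "0 < R" "ball x R \<inter> E = E" using R0 by (auto simp: R_def)
  have "hausdorff_dim E \<le> ereal t" if "s < t" for t
    unfolding hausdorff_dim_def
  proof (rule Inf_lower, safe intro!: exI[of _ t])
    show "0 \<le> t" using that \<open>0 \<le> s\<close> by simp
    have "hausdorff_premeasure t \<delta> E = 0" if \<delta>: "0 < \<delta>" for \<delta>
    proof -
      have le: "hausdorff_premeasure t \<delta> E \<le> ennreal (C * R powr s * r powr (t - s))"
        if r: "0 < r" "r < R" "r \<le> \<delta>" for r
      proof -
        have cn: "ereal_of_enat (covering_number r E) \<le> ereal (C * (R / r) powr s)"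
          using C[rule_format, OF R(1) _ x, of r] r R by simp
        then have "covering_number r E \<noteq> \<infinity>" by (cases "covering_number r E") auto
        then obtain \<U> where \<U>: "finite \<U>" "E \<subseteq> \<Union>\<U>"
          "\<And>U. U \<in> \<U> \<Longrightarrow> open U \<and> bounded U \<and> diameter U \<le> r"
          "covering_number r E = enat (card \<U>)"
          using covering_number_attained by blast
        have "real (card \<U>) \<le> C * (R / r) powr s" using cn \<U>(4) by simp
        have "hausdorff_premeasure t \<delta> E \<le> (\<Sum>U\<in>\<U>. diam_pow t U)"
          by (rule hausdorff_premeasure_le_finite_cover) (use \<U> r \<delta> in force)+
        also have "\<dots> \<le> (\<Sum>U\<in>\<U>. ennreal (r powr t))"
          using \<U>(3) \<open>s < t\<close> \<open>0 \<le> s\<close>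
          by (intro sum_mono) (auto simp: diam_pow_def intro!: ennreal_leI powr_mono2 diameter_ge_0)
        also have "\<dots> = ennreal (real (card \<U>) * r powr t)"
          by (simp add: ennreal_mult' ennreal_of_nat_eq_real_of_nat)
        also have "\<dots> \<le> ennreal (C * (R / r) powr s * r powr t)"
          using \<open>real (card \<U>) \<le> _\<close> by (intro ennreal_leI mult_right_mono) auto
        also have "C * (R / r) powr s * r powr t = C * R powr s * r powr (t - s)"
          using r R by (simp add: powr_divide powr_diff)
        finally show ?thesis .
      qed
      have "\<forall>\<^sub>F r in at_right 0. 0 \<le> (r::real)"
        by (rule eventually_mono[OF eventually_at_right_less]) simp
      then have "((\<lambda>r. C * R powr s * r powr (t - s)) \<longlongrightarrow> C * R powr s * 0) (at_right 0)"
        using \<open>s < t\<close>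
        by (intro tendsto_mult tendsto_const tendsto_zero_powrI[where b = "t - s"] tendsto_ident_at)
          simp_all
      then have "((\<lambda>r. ennreal (C * R powr s * r powr (t - s))) \<longlongrightarrow> ennreal 0) (at_right 0)"
        by (intro tendsto_ennrealI) simp
      moreover have "\<forall>\<^sub>F r in at_right 0. hausdorff_premeasure t \<delta> E \<le> ennreal (C * R powr s * r powr (t - s))"
      proof (rule eventually_mono)
        show "\<forall>\<^sub>F r in at_right 0. r \<in> {0<..<min R \<delta>}"
          using R \<delta> by (intro eventually_at_right_real) simp
      qed (rule le, auto)
      ultimately have "hausdorff_premeasure t \<delta> E \<le> ennreal 0"
        by (rule tendsto_lowerbound) simp
      then show ?thesis by simp
    qed
    then show "hausdorff_measure t E = 0" by (simp add: hausdorff_measure_def)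
  qed
  then show "hausdorff_dim E \<le> ereal s"
    using ereal_le_epsilon2[of "hausdorff_dim E" "ereal s"] by simp
qed

text \<open>A form of the mass distribution principle: a map with Hoelder inverse pushes Lebesgue
  measure on \<open>[0, 1)\<close> to a measure that gives a set \<open>U\<close> at most \<open>2 * K * diameter U powr s\<close>, so a
  cover has total \<open>s\<close>-dimensional size at least \<open>1 / (2 * K)\<close>. The preimages need not be measurable,
  so each is enclosed in an interval around one of its points.\<close>

lemma le_hausdorff_dim_if_Holder_inverse:
  fixes \<Psi> :: "real \<Rightarrow> 'a::metric_space"
  assumes "0 < s" "0 < K"
    and Holder: "\<And>x y. x \<in> {0..<1} \<Longrightarrow> y \<in> {0..<1} \<Longrightarrow> \<bar>x - y\<bar> \<le> K * dist (\<Psi> x) (\<Psi> y) powr s"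
    and E: "\<Psi> ` {0..<1} \<subseteq> E"
  shows "ereal s \<le> hausdorff_dim E"
proof -
  \<comment> \<open>With covering sets of diameter at most 1, an exponent \<open>t \<le> s\<close> only enlarges the sum;
    treating all of them at once includes \<open>t = 0\<close> with its separate convention.\<close>
  have main: "ennreal (1 / (2 * K)) \<le> hausdorff_premeasure t 1 E" if t: "0 \<le> t" "t \<le> s" for t
    unfolding hausdorff_premeasure_def
  proof (rule Inf_greatest, clarsimp)
    fix U :: "nat \<Rightarrow> 'a set"
    assume cov: "E \<subseteq> (\<Union>i. U i)" and U: "\<forall>i. bounded (U i) \<and> diameter (U i) \<le> 1"
    define A where "A i = {0..<1} \<inter> \<Psi> -` U i" for i
    define T where "T i = (if A i = {} then {} else let a = SOME a. a \<in> A i in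
       {a - K * diameter (U i) powr s..a + K * diameter (U i) powr s})" for i
    have AT: "A i \<subseteq> T i" for i
    proof
      fix x assume x: "x \<in> A i"
      define a where "a = (SOME a. a \<in> A i)"
      have a: "a \<in> A i" unfolding a_def using x by (rule someI)
      have "\<bar>x - a\<bar> \<le> K * dist (\<Psi> x) (\<Psi> a) powr s"
        using x a by (intro Holder) (auto simp: A_def)
      also have "\<dots> \<le> K * diameter (U i) powr s"
        using x a U \<open>0 < K\<close> \<open>0 < s\<close>
        by (intro mult_left_mono powr_mono2 diameter_bounded_bound) (auto simp: A_def)
      finally show "x \<in> T i" using x by (auto simp: T_def Let_def simp flip: a_def)
    qed
    have T: "emeasure lborel (T i) \<le> ennreal (2 * K) * diam_pow t (U i)" for i
    proof (cases "A i = {}")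
      case False
      then have ne: "U i \<noteq> {}" by (auto simp: A_def)
      have d: "0 \<le> diameter (U i)" "diameter (U i) \<le> 1" using U diameter_ge_0 by auto
      have "emeasure lborel (T i) = ennreal (2 * K * diameter (U i) powr s)"
        using False \<open>0 < K\<close> by (simp add: T_def Let_def)
      also have "\<dots> = ennreal (2 * K) * ennreal (diameter (U i) powr s)"
        using \<open>0 < K\<close> by (simp add: ennreal_mult')
      also have "ennreal (diameter (U i) powr s) \<le> diam_pow t (U i)"
      proof (cases "t = 0")
        case True
        then show ?thesis using ne d \<open>0 < s\<close>
          by (auto simp: diam_pow_def intro!: powr_le1)
      next
        case False
        have "diameter (U i) powr s \<le> diameter (U i) powr t"
          using d t by (cases "diameter (U i) = 0") (auto intro: powr_mono')
        then show ?thesis using ne False by (auto simp: diam_pow_def intro!: ennreal_leI)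
      qed
      finally show ?thesis by (simp add: mult_left_mono)
    qed (simp add: T_def)
    have "1 = emeasure lborel {0..<1::real}" by simp
    also have "\<dots> \<le> emeasure lborel (\<Union>i. T i)"
    proof (rule emeasure_mono)
      show "{0..<1} \<subseteq> (\<Union>i. T i)"
      proof
        fix x :: real assume "x \<in> {0..<1}"
        moreover from this obtain i where "\<Psi> x \<in> U i" using E cov by blast
        ultimately show "x \<in> (\<Union>i. T i)" using AT[of i] by (auto simp: A_def)
      qed
      show "(\<Union>i. T i) \<in> sets lborel" by (auto simp: T_def Let_def)
    qed
    also have "\<dots> \<le> (\<Sum>i. emeasure lborel (T i))"
      by (rule emeasure_subadditive_countably) (auto simp: T_def Let_def)
    also have "\<dots> \<le> (\<Sum>i. ennreal (2 * K) * diam_pow t (U i))"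
      by (intro suminf_le T) auto
    also have "\<dots> = ennreal (2 * K) * (\<Sum>i. diam_pow t (U i))" by simp
    finally have "ennreal (1 / (2 * K)) * 1
        \<le> ennreal (1 / (2 * K)) * (ennreal (2 * K) * (\<Sum>i. diam_pow t (U i)))"
      by (rule mult_left_mono) simp
    also have "\<dots> = (\<Sum>i. diam_pow t (U i))"
      using \<open>0 < K\<close> by (simp add: mult.assoc[symmetric] ennreal_mult[symmetric])
    finally show "ennreal (1 / (2 * K)) \<le> (\<Sum>i. diam_pow t (U i))" by simp
  qed
  show ?thesis
    unfolding hausdorff_dim_def
  proof (rule Inf_greatest, clarsimp)
    fix t :: real assume t: "0 \<le> t" and null: "hausdorff_measure t E = 0"
    show "s \<le> t"
    proof (rule ccontr)
      assume "\<not> s \<le> t"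
      then have "ennreal (1 / (2 * K)) \<le> hausdorff_premeasure t 1 E" using main t by simp
      also have "\<dots> \<le> hausdorff_measure t E"
        unfolding hausdorff_measure_def by (rule SUP_upper) simp
      finally show False using null \<open>0 < K\<close> by (simp add: ennreal_eq_0_iff)
    qed
  qed
qed

section \<open>Binary digits\<close>

definition binary_digit :: "real \<Rightarrow> nat \<Rightarrow> bool" where
  "binary_digit x i = odd \<lfloor>2 ^ Suc i * x\<rfloor>"

lemma floor_binary_step: "\<lfloor>2 ^ Suc n * x\<rfloor> = 2 * \<lfloor>2 ^ n * x\<rfloor> + of_bool (binary_digit x n)"
proof -
  let ?m = "\<lfloor>2 ^ n * x\<rfloor>"
  have "2 * ?m \<le> \<lfloor>2 ^ Suc n * x\<rfloor>" "\<lfloor>2 ^ Suc n * x\<rfloor> \<le> 2 * ?m + 1"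
    by (simp_all add: mult.assoc) linarith+
  then have "\<lfloor>2 ^ Suc n * x\<rfloor> = 2 * ?m \<or> \<lfloor>2 ^ Suc n * x\<rfloor> = 2 * ?m + 1" by linarith
  then show ?thesis unfolding binary_digit_def by auto
qed

text \<open>This identity is used in two ways: it shows that numbers with the same first \<open>n\<close> digits are
  \<open>2^(-n)\<close>-close, and it expands an integer \<open>k < 2^n\<close>, through the fraction \<open>k / 2^n\<close>.\<close>

lemma floor_eq_sum_binary_digits:
  assumes "x \<in> {0..<1}"
  shows "\<lfloor>2 ^ n * x\<rfloor> = (\<Sum>i<n. of_bool (binary_digit x i) * 2 ^ (n - Suc i))"
proof (induction n)
  case 0
  then show ?case using assms by (simp add: floor_eq_iff)
next
  case (Suc n)
  have "(\<Sum>i<n. of_bool (binary_digit x i) * 2 ^ (n - i)) =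
      2 * (\<Sum>i<n. of_bool (binary_digit x i) * (2::int) ^ (n - Suc i))"
    unfolding sum_distrib_left
  proof (rule sum.cong)
    fix i assume "i \<in> {..<n}"
    then have "n - i = Suc (n - Suc i)" by auto
    then show "of_bool (binary_digit x i) * 2 ^ (n - i) =
        2 * (of_bool (binary_digit x i) * (2::int) ^ (n - Suc i))" by simp
  qed simp
  then show ?case using Suc.IH by (simp add: floor_binary_step del: power_Suc)
qed

lemma dist_le_if_binary_digits_agree:
  assumes "x \<in> {0..<1}" "y \<in> {0..<1}" "\<forall>i<n. binary_digit x i = binary_digit y i"
  shows "\<bar>x - y\<bar> \<le> (1/2) ^ n"
proof -
  have "\<lfloor>2 ^ n * x\<rfloor> = \<lfloor>2 ^ n * y\<rfloor>"
    unfolding floor_eq_sum_binary_digits[OF assms(1)] floor_eq_sum_binary_digits[OF assms(2)]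
    using assms(3) by (intro sum.cong) auto
  then have "\<bar>2 ^ n * x - 2 ^ n * y\<bar> \<le> 1" by linarith
  then have "2 ^ n * \<bar>x - y\<bar> \<le> 1"
    by (simp add: abs_mult flip: right_diff_distrib)
  then show ?thesis by (simp add: power_divide field_simps)
qed

section \<open>Sets coded by binary sequences\<close>

lemma first_difference:
  fixes a b :: "nat \<Rightarrow> 'a"
  assumes "a \<noteq> b"
  obtains n where "a n \<noteq> b n" "\<forall>i<n. a i = b i"
proof -
  have "\<exists>n. a n \<noteq> b n" using assms by auto
  then have "a (LEAST n. a n \<noteq> b n) \<noteq> b (LEAST n. a n \<noteq> b n)" by (rule LeastI_ex)
  then show thesis by (rule that) (use not_less_Least in blast)
qed

text \<open>Tychonoff's theorem for the product topology on functions.\<close>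

lemma compact_binary_sequences: "compact (UNIV :: (nat \<Rightarrow> bool) set)"
proof -
  have "compactin (product_topology (\<lambda>_::nat. euclidean) UNIV) (PiE UNIV (\<lambda>_. UNIV :: bool set))"
    unfolding compactin_PiE by (auto intro: finite_imp_compact)
  then show ?thesis by (simp add: euclidean_product_topology)
qed

text \<open>The range of such a \<open>\<Phi>\<close> is a bi-Lipschitz image of the space of binary sequences in which
  sequences that first differ at index \<open>n\<close> have distance \<open>lam^n\<close>. At each scale \<open>lam^n\<close> it consists of
  \<open>2^n = (lam^n) powr (- s)\<close> cylinders, whence its dimensions.\<close>

locale cantor_coding =
  fixes \<Phi> :: "(nat \<Rightarrow> bool) \<Rightarrow> 'a::metric_space" and lam s c C :: real
  assumes lam: "0 < lam" "lam < 1" and s: "0 < s" and lam_powr: "lam powr s = 1 / 2"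
    and c: "0 < c" and C: "0 < C"
    and dist_le: "\<And>a b n. \<forall>i<n. a i = b i \<Longrightarrow> dist (\<Phi> a) (\<Phi> b) \<le> C * lam ^ n"
    and dist_ge: "\<And>a b n. \<forall>i<n. a i = b i \<Longrightarrow> a n \<noteq> b n \<Longrightarrow> c * lam ^ n \<le> dist (\<Phi> a) (\<Phi> b)"
begin

lemma lam_power_powr: "(lam ^ n) powr s = (1 / 2) ^ n"
proof -
  have "(lam ^ n) powr s = (lam powr s) powr real n"
    using lam by (simp add: powr_powr mult.commute flip: powr_realpow)
  then show ?thesis by (simp add: lam_powr powr_realpow)
qed

lemma agree_if_dist_less:
  assumes "dist (\<Phi> a) (\<Phi> b) < c * lam ^ n"
  shows "\<forall>i\<le>n. a i = b i"
proof (rule ccontr)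
  assume neg: "\<not> (\<forall>i\<le>n. a i = b i)"
  then have "a \<noteq> b" by auto
  then obtain m where m: "a m \<noteq> b m" "\<forall>i<m. a i = b i"
    by (rule first_difference)
  then have "m \<le> n" using neg by (metis linorder_not_le order_le_less_trans)
  then have "c * lam ^ n \<le> c * lam ^ m"
    using c lam by (intro mult_left_mono power_decreasing) auto
  also have "\<dots> \<le> dist (\<Phi> a) (\<Phi> b)" using m by (intro dist_ge) auto
  finally show False using assms by simp
qed

text \<open>The first power below a threshold: the second conclusion says that it is not much below, unless
  the exponent is already 0.\<close>

lemma small_power:
  assumes "0 < \<epsilon>" "0 < A"
  obtains n where "A * lam ^ n < \<epsilon>" "n = 0 \<or> \<epsilon> \<le> A * lam ^ (n - 1)"
proof -
  have ex: "\<exists>n. A * lam ^ n < \<epsilon>"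
    using real_arch_pow_inv[of "\<epsilon> / A" lam] assms lam by (auto simp: field_simps)
  define n where "n = (LEAST n. A * lam ^ n < \<epsilon>)"
  have "A * lam ^ n < \<epsilon>" unfolding n_def using ex by (rule LeastI_ex)
  moreover have "n = 0 \<or> \<epsilon> \<le> A * lam ^ (n - 1)"
    using not_less_Least[of "n - 1" "\<lambda>n. A * lam ^ n < \<epsilon>"] by (cases "n = 0") (simp_all add: not_less flip: n_def)
  ultimately show thesis by (rule that)
qed

lemma compact_range: "compact (range \<Phi>)"
proof (rule compact_continuous_image[OF _ compact_binary_sequences], unfold continuous_on_topological, safe)
  fix a B assume "open B" "\<Phi> a \<in> B"
  then obtain \<epsilon> where \<epsilon>: "0 < \<epsilon>" "ball (\<Phi> a) \<epsilon> \<subseteq> B" by (auto simp: open_contains_ball)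
  obtain n where n: "C * lam ^ n < \<epsilon>" by (rule small_power[OF \<epsilon>(1) C]) (rule that)
  define A where "A = PiE UNIV (\<lambda>i. if i < n then {a i} else UNIV)"
  have "open A" unfolding A_def
  proof (rule open_PiE)
    show "finite {i. (if i < n then {a i} else UNIV) \<noteq> UNIV}"
      by (rule finite_subset[of _ "{..<n}"]) auto
  qed (auto intro: open_discrete)
  moreover have "\<Phi> b \<in> B" if "b \<in> A" for b
  proof -
    have "\<forall>i<n. a i = b i" using that by (auto simp: A_def PiE_iff split: if_splits)
    then have "dist (\<Phi> a) (\<Phi> b) \<le> C * lam ^ n" by (rule dist_le)
    then show ?thesis using \<epsilon> n by auto
  qed
  moreover have "a \<in> A" by (auto simp: A_def PiE_iff)
  ultimately show "\<exists>A. open A \<and> a \<in> A \<and> (\<forall>y\<in>UNIV. y \<in> A \<longrightarrow> \<Phi> y \<in> B)"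
    by (intro exI[of _ A]) simp
qed

text \<open>The ball of radius \<open>R\<close> about \<open>\<Phi> a\<close> meets only the cylinder of level \<open>n\<close> around \<open>a\<close>, where \<open>lam^n\<close>
  is comparable to \<open>R\<close> (or \<open>n = 0\<close>), and this cylinder is covered by its \<open>2^k\<close> subcylinders of level
  \<open>n + k\<close>, where \<open>lam^(n + k)\<close> is comparable to \<open>r\<close> (or \<open>k = 0\<close>). Then \<open>2^k = (lam^k) powr (- s)\<close> is at
  most a constant times \<open>(R / r) powr s\<close>.\<close>

lemma assouad_dim_range_le: "assouad_dim (range \<Phi>) \<le> ereal s"
proof -
  define M where "M = 1 + (2 * C / (c * lam ^ 2)) powr s"
  show ?thesis
  proof (rule assouad_dim_le[where C = M])
    show "0 \<le> s" using s by simp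
    show "0 < M" unfolding M_def by (simp add: add_pos_nonneg)
    fix R r :: real and x assume r: "0 < r" "r < R" and "x \<in> range \<Phi>"
    then obtain a where a: "x = \<Phi> a" by auto
    have "0 < R" using r by simp
    obtain n where n: "c * lam * lam ^ n < R" "n = 0 \<or> R \<le> c * lam * lam ^ (n - 1)"
      using small_power[OF \<open>0 < R\<close>, of "c * lam"] c lam by auto
    have agree: "\<forall>i<n. a i = b i" if "dist (\<Phi> a) (\<Phi> b) < R" for b
    proof (cases n)
      case (Suc m)
      then have "R \<le> c * lam ^ n" using n by (simp add: mult_ac)
      then show ?thesis using agree_if_dist_less[of a b n] that by auto
    qed simp
    obtain k where k: "2 * C * lam ^ n * lam ^ k < r" "k = 0 \<or> r \<le> 2 * C * lam ^ n * lam ^ (k - 1)"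
      using small_power[OF \<open>0 < r\<close>, of "2 * C * lam ^ n"] C lam by auto
    \<comment> \<open>Continue the first \<open>n\<close> digits of \<open>a\<close> by those of \<open>u\<close>, then by zeros.\<close>
    define code where "code u i = (if i < n then a i else i - n \<in> u)" for u and i :: nat
    define P where "P = (\<lambda>u. \<Phi> (code u)) ` Pow {..<k}"
    have "finite P" by (simp add: P_def)
    moreover have "ball x R \<inter> range \<Phi> \<subseteq> (\<Union>y\<in>P. ball y (r / 2))"
    proof safe
      fix b assume "\<Phi> b \<in> ball x R"
      then have ab: "\<forall>i<n. a i = b i" using agree by (simp add: a)
      define u where "u = {i. i < k \<and> b (n + i)}"
      have "\<forall>i<n + k. code u i = b i"
        using ab by (auto simp: code_def u_def)
      then have "dist (\<Phi> (code u)) (\<Phi> b) \<le> C * lam ^ (n + k)" by (rule dist_le)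
      also have "\<dots> < r / 2" using k(1) by (simp add: power_add)
      finally show "\<Phi> b \<in> (\<Union>y\<in>P. ball y (r / 2))"
        unfolding P_def by (auto intro!: bexI[of _ u] simp: u_def)
    qed
    moreover have "real (card P) \<le> M * (R / r) powr s"
    proof -
      have "card P \<le> 2 ^ k"
        unfolding P_def using card_image_le[of "Pow {..<k}"] by (simp add: card_Pow)
      then have "real (card P) \<le> 2 ^ k"
        by (metis of_nat_le_iff of_nat_numeral of_nat_power)
      also have "\<dots> \<le> M * (R / r) powr s"
      proof (cases k)
        case 0
        have "1 \<le> (R / r) powr s" using r s by (intro ge_one_powr_ge_zero) auto
        moreover have "1 \<le> M" by (simp add: M_def)
        ultimately have "1 * 1 \<le> M * (R / r) powr s" by (intro mult_mono) auto
        then show ?thesis using 0 by simp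
      next
        case (Suc j)
        have "r * lam \<le> 2 * C * lam ^ n * lam ^ k"
          using k Suc lam by (simp add: mult_ac)
        also have "lam ^ n \<le> R / (c * lam)" using n c lam by (simp add: field_simps)
        finally have "r * lam \<le> 2 * C * (R / (c * lam)) * lam ^ k"
          using C lam by (simp add: mult_right_mono mult_left_mono)
        then have "1 / lam ^ k \<le> 2 * C / (c * lam ^ 2) * (R / r)"
          using r c lam by (simp add: field_simps power2_eq_square)
        then have "(1 / lam ^ k) powr s \<le> (2 * C / (c * lam ^ 2) * (R / r)) powr s"
          using s lam by (intro powr_mono2) auto
        moreover have "(1 / lam ^ k) powr s = 2 ^ k"
          using lam by (simp add: powr_divide lam_power_powr power_divide)
        moreover have "(2 * C / (c * lam ^ 2) * (R / r)) powr s =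
            (2 * C / (c * lam ^ 2)) powr s * (R / r) powr s"
          using C c lam r by (intro powr_mult)
        ultimately show ?thesis by (simp add: M_def distrib_right add_increasing)
      qed
      finally show ?thesis .
    qed
    ultimately show "\<exists>P. finite P \<and> ball x R \<inter> range \<Phi> \<subseteq> (\<Union>y\<in>P. ball y (r / 2)) \<and>
        real (card P) \<le> M * (R / r) powr s" by blast
  qed
qed

text \<open>Reading the digits of a number in \<open>[0, 1)\<close> as a code turns a distance of at least \<open>c * lam^n\<close> in
  the range into a difference of at most \<open>2^(-n) = (lam^n) powr s\<close> of numbers: the inverse map is
  Hoelder with exponent \<open>s\<close>.\<close>

lemma le_hausdorff_dim_range: "ereal s \<le> hausdorff_dim (range \<Phi>)"
proof (rule le_hausdorff_dim_if_Holder_inverse[where \<Psi> = "\<lambda>x. \<Phi> (binary_digit x)"])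
  show "0 < 1 / c powr s" using c by simp
  fix x y :: real assume xy: "x \<in> {0..<1}" "y \<in> {0..<1}"
  show "\<bar>x - y\<bar> \<le> 1 / c powr s * dist (\<Phi> (binary_digit x)) (\<Phi> (binary_digit y)) powr s"
  proof (cases "binary_digit x = binary_digit y")
    case True
    have "\<bar>x - y\<bar> \<le> (1 / 2) ^ n" for n
      using xy True by (intro dist_le_if_binary_digits_agree) auto
    then have "\<bar>x - y\<bar> \<le> 0"
      by (intro LIMSEQ_le_const[OF LIMSEQ_power_zero[of "1/2"]]) auto
    then show ?thesis using c by (simp add: order_trans)
  next
    case False
    then obtain n where n: "binary_digit x n \<noteq> binary_digit y n"
      "\<forall>i<n. binary_digit x i = binary_digit y i" by (rule first_difference)
    have "\<bar>x - y\<bar> \<le> (1 / 2) ^ n" by (rule dist_le_if_binary_digits_agree) (use xy n in auto)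
    also have "\<dots> = (1 / c powr s) * (c * lam ^ n) powr s"
      using c lam by (simp add: powr_mult lam_power_powr)
    also have "\<dots> \<le> 1 / c powr s * dist (\<Phi> (binary_digit x)) (\<Phi> (binary_digit y)) powr s"
      using c lam s n by (intro mult_left_mono powr_mono2 dist_ge) auto
    finally show ?thesis .
  qed
qed (use s in auto)

lemma dimensions_range:
  "hausdorff_dim (range \<Phi>) = ereal s" "assouad_dim (range \<Phi>) = ereal s"
proof -
  have "hausdorff_dim (range \<Phi>) \<le> assouad_dim (range \<Phi>)"
    by (rule hausdorff_dim_le_assouad_dim) (auto intro: compact_imp_bounded compact_range)
  then show "hausdorff_dim (range \<Phi>) = ereal s" "assouad_dim (range \<Phi>) = ereal s"
    using assouad_dim_range_le le_hausdorff_dim_range by auto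
qed

end

section \<open>Series whose weights are steered by the digits read so far\<close>

lemma geometric_tail_bound:
  fixes lam W :: real
  assumes lam: "0 < lam" "lam < 1"
    and d: "\<And>j. j < n \<Longrightarrow> d j = 0" "\<And>j. n \<le> j \<Longrightarrow> \<bar>d j\<bar> \<le> W * lam ^ j"
  shows "summable d" "\<bar>suminf d\<bar> \<le> W * lam ^ n / (1 - lam)"
proof -
  define g where "g j = (if j < n then 0 else W * lam ^ j)" for j
  have "(\<lambda>i. W * lam ^ n * lam ^ i) sums (W * lam ^ n * (1 / (1 - lam)))"
    using lam by (intro sums_mult geometric_sums) simp
  then have "(\<lambda>i. g (i + n)) sums (W * lam ^ n / (1 - lam))"
    by (simp add: g_def power_add mult.assoc mult.left_commute mult.commute)
  then have g: "g sums (W * lam ^ n / (1 - lam))"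
    using sums_iff_shift[of g n "W * lam ^ n / (1 - lam)"] by (simp add: g_def)
  have le: "norm (d j) \<le> g j" for j
    using d by (auto simp: g_def)
  show "summable d"
    using sums_summable[OF g] le by (rule summable_comparison_test'[where N = 0])
  show "\<bar>suminf d\<bar> \<le> W * lam ^ n / (1 - lam)"
    using norm_suminf_le[OF le sums_summable[OF g]] sums_unique[OF g] by simp
qed

definition weighted_series :: "real \<Rightarrow> ((nat \<Rightarrow> bool) \<Rightarrow> nat \<Rightarrow> real) \<Rightarrow> (nat \<Rightarrow> bool) \<Rightarrow> real" where
  "weighted_series lam w a = (\<Sum>j. of_bool (a j) * lam ^ j * w a j)"

lemma summable_weighted_series:
  fixes lam W :: real
  assumes "0 < lam" "lam < 1" "\<And>j. \<bar>w a j\<bar> \<le> W"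
  shows "summable (\<lambda>j. of_bool (a j) * lam ^ j * w a j)"
proof (rule geometric_tail_bound[where n = 0 and W = W])
  fix j
  have "0 \<le> W" using assms(3)[of 0] by linarith
  moreover have "lam ^ j * \<bar>w a j\<bar> \<le> lam ^ j * W" by (rule mult_left_mono[OF assms(3)]) (use assms(1) in simp)
  ultimately show "\<bar>of_bool (a j) * lam ^ j * w a j\<bar> \<le> W * lam ^ j"
    using assms(1) by (cases "a j") (simp_all add: abs_mult mult.commute)
qed (simp_all add: assms(1,2))

text \<open>Predictability makes all terms before the first difference of \<open>a\<close> and \<open>b\<close> cancel, whatever the
  weights are; the rest is a geometric tail.\<close>

lemma weighted_series_diff_le:
  fixes lam W :: real
  assumes lam: "0 < lam" "lam < 1" and W: "\<And>a j. \<bar>w a j\<bar> \<le> W"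
    and predictable: "\<And>a b j. \<forall>i<j. a i = b i \<Longrightarrow> w a j = w b j"
    and agree: "\<forall>i<n. a i = b i"
  shows "\<bar>weighted_series lam w a - weighted_series lam w b\<bar> \<le> 2 * W * lam ^ n / (1 - lam)"
proof -
  let ?f = "\<lambda>a j. of_bool (a j) * lam ^ j * w a j"
  have "0 \<le> W" using W[of undefined 0] by linarith
  have f: "\<bar>?f a j\<bar> \<le> W * lam ^ j" for a j
  proof -
    have "lam ^ j * \<bar>w a j\<bar> \<le> lam ^ j * W" by (rule mult_left_mono[OF W]) (use lam in simp)
    then show ?thesis using lam \<open>0 \<le> W\<close> by (cases "a j") (simp_all add: abs_mult mult.commute)
  qed
  have eq: "weighted_series lam w a - weighted_series lam w b = (\<Sum>j. ?f a j - ?f b j)"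
    unfolding weighted_series_def
    by (rule suminf_diff[OF summable_weighted_series[OF lam W] summable_weighted_series[OF lam W]])
  show ?thesis
    unfolding eq
  proof (rule geometric_tail_bound[OF lam])
    fix j assume "j < n"
    have "w a j = w b j" by (rule predictable) (use agree \<open>j < n\<close> in simp)
    moreover have "a j = b j" using agree \<open>j < n\<close> by simp
    ultimately show "?f a j - ?f b j = 0" by simp
  next
    fix j
    have "\<bar>x - y\<bar> \<le> 2 * K" if "\<bar>x\<bar> \<le> K" "\<bar>y\<bar> \<le> K" for x y K :: real
      using that by linarith
    from this[OF f f] show "\<bar>?f a j - ?f b j\<bar> \<le> 2 * W * lam ^ j"
      by (simp only: mult.assoc)
  qed
qed

text \<open>The first differing term \<open>lam^n\<close> minus the sum \<open>lam^(n + 1) / (1 - lam)\<close> of all later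
  powers. For \<open>lam < 1/2\<close> this is positive.\<close>

lemma unweighted_series_diff_ge:
  assumes lam: "0 < lam" "lam < 1" and agree: "\<forall>i<n. a i = b i" and diff: "a n \<noteq> b n"
  shows "(1 - 2 * lam) / (1 - lam) * lam ^ n
    \<le> \<bar>weighted_series lam (\<lambda>_ _. 1) a - weighted_series lam (\<lambda>_ _. 1) b\<bar>"
proof -
  let ?d = "\<lambda>j. of_bool (a j) * lam ^ j - of_bool (b j) * lam ^ j"
  let ?e = "\<lambda>j. if j = n then 0 else ?d j"
  let ?s = "\<lambda>j. if j = n then ?d n else 0"
  have eq: "weighted_series lam (\<lambda>_ _. 1) a - weighted_series lam (\<lambda>_ _. 1) b = suminf ?d"
    unfolding weighted_series_def mult_1_right
    using summable_weighted_series[OF lam, of "\<lambda>_ _. 1" _ 1]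
    by (intro suminf_diff) simp_all
  have e: "?e j = 0" if "j < Suc n" for j
    using that agree by auto
  have e': "\<bar>?e j\<bar> \<le> 1 * lam ^ j" for j
    using lam by auto
  note tail = geometric_tail_bound[OF lam, of "Suc n" ?e 1, OF e e']
  have "?s sums ?d n" by (rule sums_single)
  moreover have "?e sums suminf ?e" using tail(1) by (rule summable_sums)
  ultimately have "(\<lambda>j. ?s j + ?e j) sums (?d n + suminf ?e)" by (rule sums_add)
  moreover have "(\<lambda>j. ?s j + ?e j) = ?d" by auto
  ultimately have "suminf ?d = ?d n + suminf ?e" by (simp add: sums_iff)
  moreover have "\<bar>?d n\<bar> = lam ^ n" using diff lam by auto
  ultimately have "lam ^ n - lam ^ Suc n / (1 - lam) \<le> \<bar>suminf ?d\<bar>"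
    using tail(2) by linarith
  moreover have "(1 - 2 * lam) / (1 - lam) * lam ^ n = lam ^ n - lam ^ Suc n / (1 - lam)"
    using lam by (simp add: field_simps)
  ultimately show ?thesis using eq by simp
qed

section \<open>The planar set\<close>

text \<open>The slope is clipped to \<open>[0, 1]\<close> to keep the weights bounded when all pairs of a length and a
  rational are enumerated.\<close>

definition block_slope :: "rat \<Rightarrow> real" where
  "block_slope q = max 0 (min 1 (of_rat q))"

text \<open>The weight of the digit number \<open>i\<close> after a first zero at index \<open>m\<close>. The slope shears the whole
  cylinder so that its projection in the direction with tangent \<open>q\<close> shows the first summand alone,
  which makes \<open>n\<close> digits count like the digits of an integer: it replaces the factor \<open>lam^i\<close> by a
  multiple of \<open>2^(-i)\<close>.\<close>

definition block_weight :: "real \<Rightarrow> nat \<Rightarrow> nat \<Rightarrow> real" where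
  "block_weight lam m i =
     (case from_nat m of (n, q) \<Rightarrow> (if i < n then (2 * lam) ^ (n - i) else 0) - block_slope q)"

text \<open>The position of the first zero selects the pattern. Up to and including that zero the weight is
  0, so the choice is made before it has any effect, and the weights are predictable.\<close>

definition steering_weight :: "real \<Rightarrow> (nat \<Rightarrow> bool) \<Rightarrow> nat \<Rightarrow> real" where
  "steering_weight lam a j =
     (if \<exists>m<j. \<not> a m then block_weight lam (LEAST m. \<not> a m) (j - Suc (LEAST m. \<not> a m)) else 0)"

definition planar_point :: "real \<Rightarrow> (nat \<Rightarrow> bool) \<Rightarrow> real^2" where
  "planar_point lam a = vector [weighted_series lam (steering_weight lam) a, weighted_series lam (\<lambda>_ _. 1) a]"

lemma steering_weight_bound:
  assumes "0 < lam" "lam < 1 / 2"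
  shows "\<bar>steering_weight lam a j\<bar> \<le> 2"
proof -
  have "\<bar>block_weight lam m i\<bar> \<le> 2" for m i
  proof -
    obtain n q where nq: "from_nat m = (n :: nat, q :: rat)" by fastforce
    have "(2 * lam) ^ (n - i) \<le> 1" using assms by (intro power_le_one) auto
    moreover have "0 \<le> (2 * lam) ^ (n - i)" using assms by simp
    moreover have "0 \<le> block_slope q" "block_slope q \<le> 1" by (auto simp: block_slope_def)
    ultimately show ?thesis
      unfolding block_weight_def nq prod.case by (auto simp del: power_mult_distrib)
  qed
  then show ?thesis by (simp add: steering_weight_def)
qed

lemma Least_zero_eq:
  fixes a :: "nat \<Rightarrow> bool"
  assumes "\<forall>i<m. a i" "\<not> a m"
  shows "(LEAST m. \<not> a m) = m"
  by (rule Least_equality) (use assms leI in blast)+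

lemma steering_weight_predictable:
  assumes "\<forall>i<j. a i = b i"
  shows "steering_weight lam a j = steering_weight lam b j"
proof (cases "\<exists>m<j. \<not> a m")
  case True
  then obtain m0 where m0: "m0 < j" "\<not> a m0" by blast
  define m where "m = (LEAST m. \<not> a m)"
  have "\<not> a m" unfolding m_def using m0(2) by (rule LeastI)
  have "m \<le> m0" unfolding m_def using m0(2) by (rule Least_le)
  then have "m < j" using m0(1) by simp
  have least_a: "(LEAST m. \<not> a m) = m" by (simp add: m_def)
  have "\<not> b m" using assms \<open>\<not> a m\<close> \<open>m < j\<close> by simp
  moreover have "b i" if "i < m" for i
    using assms that \<open>m < j\<close> not_less_Least[of i "\<lambda>m. \<not> a m"] by (simp add: m_def)
  ultimately have least_b: "(LEAST m. \<not> b m) = m"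
    by (intro Least_zero_eq) simp_all
  have "\<exists>m<j. \<not> b m" using \<open>\<not> b m\<close> \<open>m < j\<close> by blast
  with True show ?thesis unfolding steering_weight_def least_a least_b by simp
qed (use assms in \<open>auto simp: steering_weight_def\<close>)

lemma inner_direction: "u \<bullet> direction \<theta> = cos \<theta> * u $ 1 + sin \<theta> * u $ 2"
  by (simp add: direction_def inner_vec_def sum_2)

lemma dist_line_proj: "dist (line_proj \<theta> u) (line_proj \<theta> v) = \<bar>(u - v) \<bullet> direction \<theta>\<bar>"
  by (simp add: line_proj_def dist_norm norm_direction inner_diff_left flip: scaleR_left_diff_distrib)

lemma planar_point_diff:
  assumes lam: "0 < lam" "lam < 1 / 2" and agree: "\<forall>i<n. a i = b i"
  shows "\<bar>(planar_point lam a - planar_point lam b) $ 1\<bar> \<le> 4 / (1 - lam) * lam ^ n"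
    and "\<bar>(planar_point lam a - planar_point lam b) $ 2\<bar> \<le> 2 / (1 - lam) * lam ^ n"
    and "a n \<noteq> b n \<Longrightarrow>
      (1 - 2 * lam) / (1 - lam) * lam ^ n \<le> \<bar>(planar_point lam a - planar_point lam b) $ 2\<bar>"
  using weighted_series_diff_le[of lam "steering_weight lam" 2 n a b]
    weighted_series_diff_le[of lam "\<lambda>_ _. 1" 1 n a b]
    unweighted_series_diff_ge[of lam n a b] lam agree
    steering_weight_bound[OF lam] steering_weight_predictable
  by (simp_all add: planar_point_def)

lemma cantor_coding_planar_point:
  assumes lam: "0 < lam" "lam < 1 / 2" and s: "0 < s" "lam powr s = 1 / 2"
  shows "cantor_coding (planar_point lam) lam s ((1 - 2 * lam) / (1 - lam)) (6 / (1 - lam))"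
proof
  fix a b :: "nat \<Rightarrow> bool" and n
  assume agree: "\<forall>i<n. a i = b i"
  note diff = planar_point_diff[OF lam agree]
  let ?v = "planar_point lam a - planar_point lam b"
  have "norm ?v \<le> \<bar>?v $ 1\<bar> + \<bar>?v $ 2\<bar>"
    using norm_le_l1_cart[of ?v] by (simp add: sum_2)
  also have "\<dots> \<le> 4 / (1 - lam) * lam ^ n + 2 / (1 - lam) * lam ^ n"
    by (intro add_mono diff)
  also have "\<dots> = 6 / (1 - lam) * lam ^ n" by (simp flip: distrib_right add_divide_distrib)
  finally show "dist (planar_point lam a) (planar_point lam b) \<le> 6 / (1 - lam) * lam ^ n"
    by (simp add: dist_norm)
  show "(1 - 2 * lam) / (1 - lam) * lam ^ n \<le> dist (planar_point lam a) (planar_point lam b)"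
    if "a n \<noteq> b n"
    using diff(3)[OF that] component_le_norm_cart[of ?v 2] by (simp add: dist_norm)
qed (use assms in auto)

text \<open>Heights of codes that first differ at \<open>n\<close> are at least \<open>(1 - 2 * lam) / (1 - lam) * lam^n\<close> apart,
  abscissas at most \<open>4 / (1 - lam) * lam^n\<close>. The bound on \<open>cos \<theta>\<close> is chosen so that the abscissas can
  undo at most half of the contribution of the heights.\<close>

lemma cantor_coding_steep_projection:
  assumes lam: "0 < lam" "lam < 1 / 2" and s: "0 < s" "lam powr s = 1 / 2"
    and \<theta>: "0 \<le> cos \<theta>" "cos \<theta> \<le> (1 - 2 * lam) / 16" "1 / 2 \<le> sin \<theta>"
  shows "cantor_coding (\<lambda>a. line_proj \<theta> (planar_point lam a)) lam s
    ((1 - 2 * lam) / (4 * (1 - lam))) (6 / (1 - lam))"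
proof
  fix a b :: "nat \<Rightarrow> bool" and n
  assume agree: "\<forall>i<n. a i = b i"
  note diff = planar_point_diff[OF lam agree]
  let ?v = "planar_point lam a - planar_point lam b"
  have dist: "dist (line_proj \<theta> (planar_point lam a)) (line_proj \<theta> (planar_point lam b)) =
      \<bar>cos \<theta> * ?v $ 1 + sin \<theta> * ?v $ 2\<bar>" by (simp only: dist_line_proj inner_direction)
  have "\<bar>cos \<theta> * ?v $ 1 + sin \<theta> * ?v $ 2\<bar> \<le> \<bar>cos \<theta>\<bar> * \<bar>?v $ 1\<bar> + \<bar>sin \<theta>\<bar> * \<bar>?v $ 2\<bar>"
    by (metis abs_mult abs_triangle_ineq)
  also have "\<dots> \<le> 1 * (4 / (1 - lam) * lam ^ n) + 1 * (2 / (1 - lam) * lam ^ n)"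
    by (intro add_mono mult_mono diff) auto
  also have "\<dots> = 6 / (1 - lam) * lam ^ n" by (simp flip: distrib_right add_divide_distrib)
  finally show "dist (line_proj \<theta> (planar_point lam a)) (line_proj \<theta> (planar_point lam b))
      \<le> 6 / (1 - lam) * lam ^ n" by (simp only: dist)
  show "(1 - 2 * lam) / (4 * (1 - lam)) * lam ^ n
      \<le> dist (line_proj \<theta> (planar_point lam a)) (line_proj \<theta> (planar_point lam b))"
    if "a n \<noteq> b n"
  proof -
    have "\<bar>cos \<theta> * ?v $ 1\<bar> \<le> (1 - 2 * lam) / 16 * (4 / (1 - lam) * lam ^ n)"
      unfolding abs_mult using \<theta> lam by (intro mult_mono diff) auto
    also have "\<dots> = (1 - 2 * lam) / (4 * (1 - lam)) * lam ^ n" using lam by (simp add: field_simps)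
    finally have x: "\<bar>cos \<theta> * ?v $ 1\<bar> \<le> (1 - 2 * lam) / (4 * (1 - lam)) * lam ^ n" .
    have "1 / 2 * ((1 - 2 * lam) / (1 - lam) * lam ^ n) \<le> \<bar>sin \<theta> * ?v $ 2\<bar>"
      unfolding abs_mult using \<theta> lam by (intro mult_mono diff that) auto
    also have "1 / 2 * ((1 - 2 * lam) / (1 - lam) * lam ^ n)
        = 2 * ((1 - 2 * lam) / (4 * (1 - lam)) * lam ^ n)" using lam by (simp add: field_simps)
    finally have y: "2 * ((1 - 2 * lam) / (4 * (1 - lam)) * lam ^ n) \<le> \<bar>sin \<theta> * ?v $ 2\<bar>" .
    have "K \<le> \<bar>u + v\<bar>" if "\<bar>u\<bar> \<le> K" "2 * K \<le> \<bar>v\<bar>" for u v K :: real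
      using that by linarith
    from this[OF x y] show ?thesis by (simp only: dist)
  qed
qed (use assms in auto)

section \<open>Arithmetic progressions in the flat projections\<close>

text \<open>The code whose first zero is at \<open>m\<close>, followed by the \<open>n\<close> binary digits of \<open>k\<close>, most significant
  digit first, and then zeros.\<close>

definition block_code :: "nat \<Rightarrow> nat \<Rightarrow> nat \<Rightarrow> nat \<Rightarrow> bool" where
  "block_code m n k j \<longleftrightarrow> j < m \<or> m < j \<and> j < Suc m + n \<and> binary_digit (k / 2 ^ n) (j - Suc m)"

lemma sum_lessThan_add:
  fixes f :: "nat \<Rightarrow> 'a::comm_monoid_add"
  shows "(\<Sum>j<m + n. f j) = (\<Sum>j<m. f j) + (\<Sum>i<n. f (m + i))"
  by (induction n) (simp_all add: add.assoc)

lemma sum_binary_digits_of_fraction: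
  assumes "k < 2 ^ n"
  shows "(\<Sum>i<n. of_bool (binary_digit (k / 2 ^ n) i) * 2 ^ (n - Suc i)) = real k"
proof -
  have "real k < 2 ^ n" using assms by (metis of_nat_less_iff of_nat_numeral of_nat_power)
  then have "\<lfloor>2 ^ n * (k / 2 ^ n)\<rfloor> =
      (\<Sum>i<n. of_bool (binary_digit (k / 2 ^ n) i) * 2 ^ (n - Suc i))"
    by (intro floor_eq_sum_binary_digits) simp
  then have "int k = (\<Sum>i<n. of_bool (binary_digit (k / 2 ^ n) i) * 2 ^ (n - Suc i))" by simp
  then have "real_of_int (int k) =
      real_of_int (\<Sum>i<n. of_bool (binary_digit (k / 2 ^ n) i) * 2 ^ (n - Suc i))" by (rule arg_cong)
  then show ?thesis by simp
qed

lemma steering_weight_block_code: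
  shows "j \<le> m \<Longrightarrow> steering_weight lam (block_code m n k) j = 0"
    and "steering_weight lam (block_code m n k) (Suc m + i) = block_weight lam m i"
proof -
  have "(LEAST j. \<not> block_code m n k j) = m"
    by (rule Least_zero_eq) (auto simp: block_code_def)
  moreover have "\<not> block_code m n k m" by (simp add: block_code_def)
  ultimately show "steering_weight lam (block_code m n k) (Suc m + i) = block_weight lam m i"
    unfolding steering_weight_def by auto
qed (auto simp: steering_weight_def block_code_def)

text \<open>After the \<open>m\<close> leading ones, which contribute the same for every \<open>k\<close>, each digit contributes its
  place value in \<open>2 * lam^(m + 1 + n) * k\<close> and an error proportional to \<open>t - block_slope q\<close>. The errors
  add up to at most \<open>2 * \<bar>t - block_slope q\<bar> * lam^(m + 1)\<close>, because \<open>(\<Sum>i. lam^i) \<le> 2\<close>.\<close>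

lemma block_code_near_progression:
  fixes t :: real and q :: rat
  assumes lam: "0 < lam" "lam < 1 / 2" and k: "k < 2 ^ n"
    and m: "m = to_nat (n, q)" and t: "\<bar>t - block_slope q\<bar> \<le> lam ^ n / 4"
  defines "p \<equiv> planar_point lam (block_code m n k)"
  shows "\<bar>(p $ 1 + t * p $ 2) - (t * (\<Sum>j<m. lam ^ j) + 2 * lam ^ (Suc m + n) * k)\<bar>
    \<le> lam ^ (Suc m + n) / 2"
proof -
  let ?a = "block_code m n k"
  let ?u = "\<lambda>i. of_bool (binary_digit (k / 2 ^ n) i) :: real"
  let ?f = "\<lambda>j. of_bool (?a j) * lam ^ j * (steering_weight lam ?a j + t)"
  have "p $ 1 + t * p $ 2 = suminf ?f"
  proof -
    have "summable (\<lambda>j. of_bool (?a j) * lam ^ j * steering_weight lam ?a j)"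
      using summable_weighted_series[of lam "steering_weight lam" ?a 2] lam
        steering_weight_bound[OF lam] by simp
    moreover have "summable (\<lambda>j. of_bool (?a j) * lam ^ j * t)"
      using summable_weighted_series[of lam "\<lambda>_ _. t" ?a "\<bar>t\<bar>"] lam by simp
    moreover have "(\<Sum>j. of_bool (?a j) * lam ^ j * t) = t * (\<Sum>j. of_bool (?a j) * lam ^ j)"
      using summable_weighted_series[of lam "\<lambda>_ _. 1" ?a 1] lam
      by (simp add: suminf_mult mult.commute)
    ultimately show ?thesis
      by (simp add: p_def planar_point_def weighted_series_def suminf_add[symmetric] distrib_left)
  qed
  also have "\<dots> = (\<Sum>j<Suc m + n. ?f j)"
    by (rule suminf_finite) (auto simp: block_code_def)
  also have "\<dots> = (\<Sum>j<m. ?f j) + (\<Sum>i<n. ?f (Suc m + i))"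
    by (simp only: sum_lessThan_add sum.lessThan_Suc) (simp add: block_code_def)
  also have "(\<Sum>j<m. ?f j) = t * (\<Sum>j<m. lam ^ j)"
    by (simp add: sum_distrib_left steering_weight_block_code block_code_def mult.commute)
  also have "(\<Sum>i<n. ?f (Suc m + i)) =
      (\<Sum>i<n. 2 * lam ^ (Suc m + n) * (?u i * 2 ^ (n - Suc i)) + (t - block_slope q) * lam ^ Suc m * (?u i * lam ^ i))"
  proof (rule sum.cong)
    fix i assume "i \<in> {..<n}"
    then have i: "i < n" by simp
    have weight: "steering_weight lam ?a (Suc m + i) = (2 * lam) ^ (n - i) - block_slope q"
      unfolding steering_weight_block_code(2) using i by (simp add: block_weight_def m)
    have digit: "?a (Suc m + i) = binary_digit (k / 2 ^ n) i"
      using i by (simp add: block_code_def)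
    have power: "lam ^ (Suc m + i) * (2 * lam) ^ (n - i) = 2 * lam ^ (Suc m + n) * 2 ^ (n - Suc i)"
    proof -
      have split: "lam ^ (Suc m + n) = lam ^ (Suc m + i) * lam ^ (n - i)"
        using i by (simp flip: power_add)
      have double: "(2::real) ^ (n - i) = 2 * 2 ^ (n - Suc i)"
        using i by (metis Suc_diff_Suc power_Suc)
      show ?thesis unfolding power_mult_distrib split double by (simp only: mult_ac)
    qed
    have "?f (Suc m + i) = ?u i * (lam ^ (Suc m + i) * (2 * lam) ^ (n - i))
        + (t - block_slope q) * (?u i * lam ^ (Suc m + i))"
      unfolding weight digit by (simp add: algebra_simps del: power_Suc power_mult_distrib)
    also have "\<dots> = 2 * lam ^ (Suc m + n) * (?u i * 2 ^ (n - Suc i))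
        + (t - block_slope q) * lam ^ Suc m * (?u i * lam ^ i)"
      unfolding power unfolding power_add[of lam "Suc m" i] by (simp only: mult_ac)
    finally show "?f (Suc m + i) = 2 * lam ^ (Suc m + n) * (?u i * 2 ^ (n - Suc i))
        + (t - block_slope q) * lam ^ Suc m * (?u i * lam ^ i)" .
  qed simp
  also have "\<dots> = 2 * lam ^ (Suc m + n) * k
      + (t - block_slope q) * lam ^ Suc m * (\<Sum>i<n. ?u i * lam ^ i)"
    using sum_binary_digits_of_fraction[OF k] by (simp only: sum.distrib flip: sum_distrib_left)
  finally have eq: "(p $ 1 + t * p $ 2) - (t * (\<Sum>j<m. lam ^ j) + 2 * lam ^ (Suc m + n) * k)
      = (t - block_slope q) * lam ^ Suc m * (\<Sum>i<n. ?u i * lam ^ i)" by simp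
  have z: "0 \<le> (\<Sum>i<n. ?u i * lam ^ i)" "(\<Sum>i<n. ?u i * lam ^ i) \<le> 2"
  proof -
    show "0 \<le> (\<Sum>i<n. ?u i * lam ^ i)" using lam by (intro sum_nonneg) simp
    have "(\<Sum>i<n. ?u i * lam ^ i) \<le> (\<Sum>i<n. lam ^ i)" using lam by (intro sum_mono) simp
    also have "\<dots> = (1 - lam ^ n) / (1 - lam)" using lam by (simp add: sum_gp_strict)
    also have "\<dots> \<le> 1 / (1 / 2)" using lam by (intro frac_le) auto
    finally show "(\<Sum>i<n. ?u i * lam ^ i) \<le> 2" by simp
  qed
  have "\<bar>(t - block_slope q) * lam ^ Suc m * (\<Sum>i<n. ?u i * lam ^ i)\<bar>
      \<le> (lam ^ n / 4) * lam ^ Suc m * 2"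
    unfolding abs_mult using t z lam by (intro mult_mono) auto
  then show ?thesis unfolding eq by (simp add: power_add mult_ac)
qed

lemma ex_block_slope_near:
  assumes "0 \<le> t" "t \<le> 1" "0 < \<epsilon>"
  shows "\<exists>q. \<bar>t - block_slope q\<bar> \<le> \<epsilon>"
proof -
  obtain q where "t - \<epsilon> < of_rat q" "of_rat q < t + \<epsilon>"
    using of_rat_dense[of "t - \<epsilon>" "t + \<epsilon>"] assms by auto
  then show ?thesis using assms by (intro exI[of _ q]) (auto simp: block_slope_def)
qed

text \<open>For each \<open>n\<close>, a pair \<open>(n, q)\<close> with \<open>q\<close> close to \<open>tan \<theta>\<close> yields \<open>2^n\<close> points whose distances from a
  progression with gap \<open>2 * D\<close> are at most \<open>D / 2\<close>. They are therefore \<open>D\<close>-separated and lie within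
  \<open>2 * 2^n * D\<close> of each other, all scaled by \<open>cos \<theta>\<close>.\<close>

lemma assouad_dim_flat_projection:
  assumes lam: "0 < lam" "lam < 1 / 2" and \<theta>: "0 < cos \<theta>" "0 \<le> tan \<theta>" "tan \<theta> \<le> 1"
  shows "assouad_dim (line_proj \<theta> ` range (planar_point lam)) = 1"
proof (rule antisym)
  let ?F = "line_proj \<theta> ` range (planar_point lam)"
  show "assouad_dim ?F \<le> 1"
    by (rule assouad_dim_line_subset_le[OF norm_direction[of \<theta>]]) (auto simp: line_proj_def)
  show "1 \<le> assouad_dim ?F"
  proof (rule one_le_assouad_dim_if_separated[of 4])
    fix n :: nat
    define t where "t = tan \<theta>"
    obtain q where q: "\<bar>t - block_slope q\<bar> \<le> lam ^ n / 4"
      using ex_block_slope_near[of t "lam ^ n / 4"] \<theta> lam by (auto simp: t_def)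
    define m where "m = to_nat (n, q)"
    define D where "D = lam ^ (Suc m + n)"
    define p where "p k = planar_point lam (block_code m n k)" for k
    define h where "h k = p k $ 1 + t * p k $ 2" for k
    have "0 < D" using lam by (simp add: D_def)
    have h: "\<bar>h k - (t * (\<Sum>j<m. lam ^ j) + 2 * D * k)\<bar> \<le> D / 2" if "k < 2 ^ n" for k
      unfolding h_def p_def D_def by (rule block_code_near_progression[OF lam that m_def q])
    have dist: "dist (line_proj \<theta> (p k)) (line_proj \<theta> (p l)) = cos \<theta> * \<bar>h k - h l\<bar>" for k l
    proof -
      have "(p k - p l) \<bullet> direction \<theta> = cos \<theta> * (h k - h l)"
        using \<theta> by (simp add: inner_direction h_def t_def tan_def field_simps)
      then show ?thesis using \<theta> by (simp add: dist_line_proj abs_mult)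
    qed
    have sep: "D \<le> \<bar>h k - h l\<bar>" if "k < 2 ^ n" "l < 2 ^ n" "k \<noteq> l" for k l
    proof -
      have "1 \<le> \<bar>real k - real l\<bar>" using that(3) by linarith
      then have "2 * D \<le> 2 * D * \<bar>real k - real l\<bar>" using \<open>0 < D\<close> by simp
      also have "\<dots> = \<bar>2 * D * k - 2 * D * l\<bar>"
        using \<open>0 < D\<close> by (simp add: abs_mult flip: right_diff_distrib)
      finally show ?thesis using h[OF that(1)] h[OF that(2)] by linarith
    qed
    have near: "\<bar>h 0 - h k\<bar> < 2 * 2 ^ n * D" if "k < 2 ^ n" for k
    proof -
      have "real k + 1 \<le> 2 ^ n"
        using that by (metis Suc_eq_plus1 Suc_leI of_nat_1 of_nat_add of_nat_le_iff of_nat_numeral of_nat_power)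
      then have "2 * D * (real k + 1) \<le> 2 * D * 2 ^ n" using \<open>0 < D\<close> by simp
      then have "2 * D * k + 2 * D \<le> 2 * 2 ^ n * D" by (simp add: algebra_simps)
      moreover have "0 \<le> 2 * D * k" using \<open>0 < D\<close> by simp
      moreover have "\<bar>h 0 - t * (\<Sum>j<m. lam ^ j)\<bar> \<le> D / 2" using h[of 0] by simp
      ultimately show ?thesis
        using h[OF that] \<open>0 < D\<close> by linarith
    qed
    \<comment> \<open>Half the separation, because the criterion wants distances strictly above \<open>r\<close>.\<close>
    define r where "r = cos \<theta> * D / 2"
    have "0 < r" using \<theta> \<open>0 < D\<close> by (simp add: r_def)
    define P where "P = (\<lambda>k. line_proj \<theta> (p k)) ` {..<2 ^ n}"
    have r_less: "r < dist (line_proj \<theta> (p k)) (line_proj \<theta> (p l))"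
      if "k < 2 ^ n" "l < 2 ^ n" "k \<noteq> l" for k l
    proof -
      have "r < cos \<theta> * D" using \<open>0 < r\<close> unfolding r_def by linarith
      also have "\<dots> \<le> dist (line_proj \<theta> (p k)) (line_proj \<theta> (p l))"
        unfolding dist using sep[OF that] \<theta> by simp
      finally show ?thesis .
    qed
    show "\<exists>P x R r. x \<in> ?F \<and> 0 < r \<and> r < R \<and> R \<le> 4 * 2 ^ n * r \<and> P \<subseteq> ball x R \<inter> ?F \<and>
        card P = 2 ^ n \<and> (\<forall>x\<in>P. \<forall>y\<in>P. x \<noteq> y \<longrightarrow> r < dist x y)"
    proof (intro exI conjI)
      show "line_proj \<theta> (p 0) \<in> ?F" by (simp add: p_def)
      show "0 < r" by fact
      show "r < 4 * 2 ^ n * r" using \<open>0 < r\<close> less_le_trans[of 1 "4::real" "4 * 2 ^ n"] by simp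
      show "4 * 2 ^ n * r \<le> 4 * 2 ^ n * r" by simp
      show "P \<subseteq> ball (line_proj \<theta> (p 0)) (4 * 2 ^ n * r) \<inter> ?F"
      proof -
        have "dist (line_proj \<theta> (p 0)) (line_proj \<theta> (p k)) < 4 * 2 ^ n * r" if "k < 2 ^ n" for k
          using mult_strict_left_mono[OF near[OF that] \<theta>(1)] by (simp add: dist r_def mult_ac)
        then show ?thesis by (auto simp: P_def) (auto simp: p_def)
      qed
      show "card P = 2 ^ n"
        unfolding P_def using r_less \<open>0 < r\<close>
        by (subst card_image) (auto simp: inj_on_def, metis dist_self less_asym)
      show "\<forall>x\<in>P. \<forall>y\<in>P. x \<noteq> y \<longrightarrow> r < dist x y"
        using r_less unfolding P_def by auto
    qed
  qed simp
qed

section \<open>Two intervals of directions\<close>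

theorem theorem2p5:
  fixes s :: real
  assumes "log 5 3 < s" and "s < 1"
  shows "\<exists>F :: (real^2) set.
    compact F \<and> hausdorff_dim F = ereal s \<and> assouad_dim F = ereal s \<and>
    (\<exists>I J :: real set.
       is_interval I \<and> is_interval J \<and> I \<subseteq> {0..<pi} \<and> J \<subseteq> {0..<pi} \<and> I \<inter> J = {} \<and>
       0 < measure lebesgue I \<and> 0 < measure lebesgue J \<and>
       (\<forall>\<theta>\<in>I. assouad_dim (line_proj \<theta> ` F) = ereal s) \<and>
       (AE \<theta> in lebesgue. \<theta> \<in> J \<longrightarrow> assouad_dim (line_proj \<theta> ` F) = 1)) \<and>
    \<not> (\<exists>c. AE \<theta> in lebesgue. \<theta> \<in> {0..<pi} \<longrightarrow> assouad_dim (line_proj \<theta> ` F) = c)"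
proof -
  have "0 < log 5 (3::real)" by simp
  with assms have s: "0 < s" by linarith
  \<comment> \<open>The contraction ratio for which two copies make a set of dimension \<open>s\<close>.\<close>
  define lam :: real where "lam = (1 / 2) powr (1 / s)"
  have lam_powr: "lam powr s = 1 / 2" using s by (simp add: lam_def powr_powr)
  have "0 < lam" by (simp add: lam_def)
  moreover have "lam < 1 / 2"
    using powr_less_mono'[of "1 / 2 :: real" 1 "1 / s"] s assms(2) by (simp add: lam_def)
  ultimately have lam: "0 < lam" "lam < 1 / 2" by auto
  define F where "F = range (planar_point lam)"
  define \<eta> where "\<eta> = (1 - 2 * lam) / 16"
  have \<eta>: "0 < \<eta>" "\<eta> < 1 / 2" using lam by (simp_all add: \<eta>_def)
  define I where "I = {arccos \<eta>..pi / 2}"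
  define J where "J = {0..pi / 4}"
  have acos: "pi / 3 < arccos \<eta>" "arccos \<eta> < pi / 2"
    using arccos_less_arccos[of \<eta> "1 / 2"] arccos_less_arccos[of 0 \<eta>] \<eta>
      arccos_cos[of "pi / 3"] by (simp_all add: cos_60)
  have steep: "assouad_dim (line_proj \<theta> ` F) = ereal s" if "\<theta> \<in> I" for \<theta>
  proof -
    have \<theta>: "pi / 3 < \<theta>" "\<theta> \<le> pi / 2" "arccos \<eta> \<le> \<theta>" using that acos by (auto simp: I_def)
    have "0 \<le> cos \<theta>" using \<theta> pi_gt_zero by (intro cos_ge_zero) linarith+
    moreover have "cos \<theta> \<le> \<eta>"
      using cos_monotone_0_pi_le[of "arccos \<eta>" \<theta>] \<theta> acos \<eta> pi_gt_zero by (simp add: cos_arccos)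
    moreover have "1 / 2 \<le> sin \<theta>"
      using sin_monotone_2pi_le[of "pi / 6" \<theta>] \<theta> pi_gt_zero by (simp add: sin_30)
    ultimately have "cantor_coding (\<lambda>a. line_proj \<theta> (planar_point lam a)) lam s
        ((1 - 2 * lam) / (4 * (1 - lam))) (6 / (1 - lam))"
      unfolding \<eta>_def by (intro cantor_coding_steep_projection lam s lam_powr)
    from cantor_coding.dimensions_range(2)[OF this] show ?thesis
      by (simp add: F_def image_image)
  qed
  have flat: "assouad_dim (line_proj \<theta> ` F) = 1" if "\<theta> \<in> J" for \<theta>
  proof -
    have \<theta>: "0 \<le> \<theta>" "\<theta> \<le> pi / 4" using that by (auto simp: J_def)
    have "0 < cos \<theta>" using \<theta> pi_gt_zero by (intro cos_gt_zero_pi) linarith+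
    moreover have "0 \<le> tan \<theta>"
      using \<theta> pi_gt_zero \<open>0 < cos \<theta>\<close> by (auto simp: tan_def intro!: divide_nonneg_pos sin_ge_zero)
    moreover have "tan \<theta> \<le> 1"
      using tan_mono_le[of \<theta> "pi / 4"] \<theta> pi_gt_zero by (simp add: tan_45)
    ultimately show ?thesis unfolding F_def by (intro assouad_dim_flat_projection lam)
  qed
  have pos: "0 < measure lebesgue I" "0 < measure lebesgue J"
    using acos by (simp_all add: I_def J_def)
  have sub: "I \<subseteq> {0..<pi}" "J \<subseteq> {0..<pi}" "I \<inter> J = {}"
    using acos pi_gt_zero by (auto simp: I_def J_def)
  \<comment> \<open>An almost sure constant would be attained at some direction in each of the two intervals.\<close>
  have hit: "\<exists>\<theta>\<in>A. Q \<theta>" if "A = {u..v}" "u < v" "AE \<theta> in lebesgue. Q \<theta>" for A Q and u v :: real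
  proof (rule ccontr)
    assume "\<not> (\<exists>\<theta>\<in>A. Q \<theta>)"
    then have "AE \<theta> in lebesgue. \<theta> \<notin> A" using that(3) by (auto elim: eventually_mono)
    then have "emeasure lebesgue A = 0"
      by (subst (asm) AE_iff_measurable[of A]) (auto simp: that(1))
    then show False using that by simp
  qed
  have "\<not> (\<exists>c. AE \<theta> in lebesgue. \<theta> \<in> {0..<pi} \<longrightarrow> assouad_dim (line_proj \<theta> ` F) = c)"
  proof
    assume "\<exists>c. AE \<theta> in lebesgue. \<theta> \<in> {0..<pi} \<longrightarrow> assouad_dim (line_proj \<theta> ` F) = c"
    then obtain c where c: "AE \<theta> in lebesgue. \<theta> \<in> {0..<pi} \<longrightarrow> assouad_dim (line_proj \<theta> ` F) = c" ..
    obtain \<theta> where "\<theta> \<in> I" "\<theta> \<in> {0..<pi} \<longrightarrow> assouad_dim (line_proj \<theta> ` F) = c"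
      using hit[OF I_def acos(2) c] by blast
    then have "c = ereal s" using steep sub by auto
    obtain \<theta> where "\<theta> \<in> J" "\<theta> \<in> {0..<pi} \<longrightarrow> assouad_dim (line_proj \<theta> ` F) = c"
      using hit[OF J_def _ c] by auto
    then have "c = 1" using flat sub by auto
    with \<open>c = ereal s\<close> show False using assms(2) by simp
  qed
  moreover have "AE \<theta> in lebesgue. \<theta> \<in> J \<longrightarrow> assouad_dim (line_proj \<theta> ` F) = 1"
    using flat by (intro AE_I2) simp
  ultimately show ?thesis
    using cantor_coding.compact_range[OF cantor_coding_planar_point[OF lam s lam_powr]]
      cantor_coding.dimensions_range[OF cantor_coding_planar_point[OF lam s lam_powr]]
      steep sub pos
    by (intro exI[of _ F] conjI exI[of _ I] exI[of _ J])
       (auto simp: F_def I_def J_def is_interval_cc)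
qed

end
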